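(* Let $n\geq 3$. The halved $n$-cube admits instantaneous uniform mixing (at some time $\tau$) if and only if $n$ is odd.
   Context: The halved $n$-cube is the graph whose vertex set is the set of binary words of length $n$ of even Hamming weight, two words being adjacent if and only if they differ in exactly two coordinates. For a graph $X$ with adjacency matrix $A(X)$, the continuous-time quantum walk on $X$ is instantaneous uniform mixing at time $\tau$ if $|e^{-i\tau A(X)}_{a,b}|=1/\sqrt{|V(X)|}$ for all vertices $a,b$; $X$ admits instantaneous uniform mixing if this holds for some real $\tau$. *)

theory Defs
  imports "HOL-Analysis.Analysis" "Graph_Theory.Pair_Digraph"
begin

definition hamming_weight :: "bool list \<Rightarrow> nat" where
  "hamming_weight w = card {i. i < length w \<and> w ! i}"

text \<open>Only used for words of equal length.\<close>

definition hamming_dist :: "bool list \<Rightarrow> bool list \<Rightarrow> nat" where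
  "hamming_dist v w = card {i. i < length v \<and> v ! i \<noteq> w ! i}"

text \<open>An undirected edge is represented by its two arcs.\<close>

definition halved_cube :: "nat \<Rightarrow> bool list pair_pre_digraph" where
  "halved_cube n =
    \<lparr> pverts = {w. length w = n \<and> even (hamming_weight w)},
      parcs = {(v, w). length v = n \<and> even (hamming_weight v) \<and>
                       length w = n \<and> even (hamming_weight w) \<and>
                       hamming_dist v w = 2} \<rparr>"

lemma pair_graph_halved_cube: "pair_graph (halved_cube n)"
proof -
  have fin: "finite (pverts (halved_cube n))"
  proof (rule finite_subset)
    show "finite {w :: bool list. set w \<subseteq> UNIV \<and> length w = n}"
      by (rule finite_lists_length_eq) simp
  qed (auto simp: halved_cube_def)
  have sub: "parcs (halved_cube n) \<subseteq> pverts (halved_cube n) \<times> pverts (halved_cube n)"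
    by (auto simp: halved_cube_def)
  have fin': "finite (parcs (halved_cube n))"
    by (rule finite_subset[OF sub finite_cartesian_product[OF fin fin]])
  have "hamming_dist v w = hamming_dist w v" if "length v = length w" for v w
    using that by (simp add: hamming_dist_def eq_commute)
  then have "sym (parcs (halved_cube n))"
    unfolding sym_def halved_cube_def by simp
  then have sym: "symmetric (with_proj (halved_cube n))"
    by (simp add: symmetric_def)
  have "hamming_dist v v \<noteq> 2" for v
    by (simp add: hamming_dist_def)
  then have irrefl: "(v, v) \<notin> parcs (halved_cube n)" for v
    by (simp add: halved_cube_def)
  show ?thesis
  proof unfold_locales
    fix e assume e: "e \<in> parcs (halved_cube n)"
    show "fst e \<in> pverts (halved_cube n)" "snd e \<in> pverts (halved_cube n)"
      using subsetD[OF sub e] by (simp_all add: mem_Times_iff)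
    show "fst e \<noteq> snd e"
      using irrefl[of "fst e"] e by (cases e) auto
  qed (rule fin fin' sym)+
qed

text \<open>
  Since the vertex set depends on \<open>n\<close>, a square matrix with rows and columns indexed by a
  finite set \<open>V\<close> is a function \<open>V \<times> V \<Rightarrow> \<complex>\<close>, given here as a curried function on
  the whole type whose values outside \<open>V\<close> are irrelevant.
\<close>

fun mat_power_on :: "'v set \<Rightarrow> ('v \<Rightarrow> 'v \<Rightarrow> complex) \<Rightarrow> nat \<Rightarrow> 'v \<Rightarrow> 'v \<Rightarrow> complex" where
  "mat_power_on V M 0 = (\<lambda>a b. if a = b then 1 else 0)"
| "mat_power_on V M (Suc k) = (\<lambda>a b. \<Sum>c\<in>V. M a c * mat_power_on V M k c b)"

text \<open>The exponential series is summed entrywise; it converges by the lemma that follows.\<close>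

definition mat_exp_on :: "'v set \<Rightarrow> ('v \<Rightarrow> 'v \<Rightarrow> complex) \<Rightarrow> 'v \<Rightarrow> 'v \<Rightarrow> complex" where
  "mat_exp_on V M = (\<lambda>a b. \<Sum>k. mat_power_on V M k a b / fact k)"

lemma summable_mat_exp_on:
  assumes "finite V" "a \<in> V"
  shows "summable (\<lambda>k. mat_power_on V M k a b / fact k)"
proof -
  define K where "K = (\<Sum>a\<in>V. \<Sum>c\<in>V. norm (M a c))"
  have K0: "K \<ge> 0"
    by (simp add: K_def sum_nonneg)
  have row: "(\<Sum>c\<in>V. norm (M a c)) \<le> K" if "a \<in> V" for a
    unfolding K_def
    by (rule member_le_sum[where f = "\<lambda>a. \<Sum>c\<in>V. norm (M a c)"])
       (use that assms in \<open>auto intro: sum_nonneg\<close>)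
  have bound: "norm (mat_power_on V M k a b) \<le> K ^ k" if "a \<in> V" for k a
    using that
  proof (induction k arbitrary: a)
    case (Suc k)
    have "norm (mat_power_on V M (Suc k) a b)
        \<le> (\<Sum>c\<in>V. norm (M a c * mat_power_on V M k c b))"
      by (simp add: norm_sum)
    also have "\<dots> \<le> (\<Sum>c\<in>V. norm (M a c) * K ^ k)"
      by (intro sum_mono) (auto simp: norm_mult intro!: mult_left_mono Suc.IH)
    also have "\<dots> = (\<Sum>c\<in>V. norm (M a c)) * K ^ k"
      by (simp add: sum_distrib_right)
    also have "\<dots> \<le> K * K ^ k"
      using row[OF Suc.prems] K0 by (intro mult_right_mono) auto
    finally show ?case by simp
  qed auto
  show ?thesis
  proof (rule summable_comparison_test')
    show "summable (\<lambda>k. inverse (fact k) * K ^ k)"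
      by (rule summable_exp)
    show "norm (mat_power_on V M k a b / fact k) \<le> inverse (fact k) * K ^ k" for k
      using bound[OF assms(2), of k] by (simp add: norm_divide field_simps)
  qed
qed

definition adjacency_matrix :: "'v pair_pre_digraph \<Rightarrow> 'v \<Rightarrow> 'v \<Rightarrow> complex" where
  "adjacency_matrix G = (\<lambda>a b. if (a, b) \<in> parcs G then 1 else 0)"

definition transition_matrix :: "'v pair_pre_digraph \<Rightarrow> real \<Rightarrow> 'v \<Rightarrow> 'v \<Rightarrow> complex" where
  "transition_matrix G \<tau> =
    mat_exp_on (pverts G) (\<lambda>a b. - \<i> * complex_of_real \<tau> * adjacency_matrix G a b)"

definition uniform_mixing_at :: "'v pair_pre_digraph \<Rightarrow> real \<Rightarrow> bool" where
  "uniform_mixing_at G \<tau> \<longleftrightarrow>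
    (\<forall>a\<in>pverts G. \<forall>b\<in>pverts G.
       cmod (transition_matrix G \<tau> a b) = 1 / sqrt (real (card (pverts G))))"

definition admits_uniform_mixing :: "'v pair_pre_digraph \<Rightarrow> bool" where
  "admits_uniform_mixing G \<longleftrightarrow> (\<exists>\<tau>. uniform_mixing_at G \<tau>)"

end

theory Submission
  imports Defs
begin

text \<open>
  Identify words of even weight with subsets of even size of \<open>N = {..<n}\<close>. The Walsh functions
  \<open>A \<mapsto> (-1)\<^bsup>|u \<inter> A|\<^esup>\<close> diagonalise the halved cube with eigenvalues \<open>((n - 2|u|)\<^sup>2 - n) / 2\<close>, so,
  up to a unimodular constant, the entries of the transition matrix are the normalised Walsh
  transform of the quadratic phase \<open>f(u) = exp (- i \<tau> (n - 2|u|)\<^sup>2 / 2)\<close>, and uniform mixing means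
  that this transform has constant modulus on even sets. On odd sets it
  vanishes, because \<open>f\<close> is invariant under complementation.

  If \<open>n\<close> is odd and \<open>\<tau> = \<pi>/4\<close>, then \<open>n - 2|u|\<close> is an odd integer \<open>m\<close>, and for those
  \<open>exp (- i \<pi> (m\<^sup>2 - 1) / 8) = \<surd>2 cos (\<pi> m / 4)\<close>. The right-hand side is a sum of two functions that
  are products over the coordinates, whose Walsh transforms are explicit.

  Conversely, flatness forces the autocorrelation \<open>\<Sum>\<^sub>u f(u) cnj (f(u + v))\<close> to vanish for all
  \<open>v\<close> other than \<open>{}\<close> and \<open>N\<close>. For \<open>|v| = 1\<close> it equals \<open>2 (2 cos 2\<tau>)\<^bsup>n-1\<^esup>\<close>, hence
  \<open>exp (4 i \<tau>) = -1\<close>; but then, if \<open>n\<close> is even, every summand for \<open>|v| = 2\<close> equals 1.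
\<close>

section \<open>Walsh functions\<close>

definition sg :: "'a set \<Rightarrow> 'a \<Rightarrow> complex" where
  "sg u i = (if i \<in> u then -1 else 1)"

text \<open>These are the characters of the group of sets under symmetric difference. The product
  form lets sums over \<open>Pow N\<close> factor coordinatewise.\<close>

definition walsh :: "'a set \<Rightarrow> 'a set \<Rightarrow> complex" where
  "walsh u A = (\<Prod>i\<in>A. sg u i)"

definition imbalance :: "'a set \<Rightarrow> 'a set \<Rightarrow> complex" where
  "imbalance N u = (\<Sum>i\<in>N. sg u i)"

lemma sg_sym_diff: "sg (sym_diff u v) i = sg u i * sg v i"
  by (auto simp: sg_def)

lemma walsh_eq: "finite A \<Longrightarrow> walsh u A = (-1) ^ card (u \<inter> A)"
  unfolding walsh_def sg_def by (subst prod.If_cases) (auto simp: Int_commute)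

lemma walsh_commute: "finite A \<Longrightarrow> finite u \<Longrightarrow> walsh u A = walsh A u"
  by (simp add: walsh_eq Int_commute)

lemma walsh_self: "finite A \<Longrightarrow> u \<subseteq> A \<Longrightarrow> walsh A u = (-1) ^ card u"
  by (simp add: walsh_eq finite_subset Int_absorb1)

lemma cnj_sg [simp]: "cnj (sg u i) = sg u i"
  by (simp add: sg_def)

lemma cnj_walsh [simp]: "cnj (walsh u A) = walsh u A"
  by (simp add: walsh_def)

lemma cnj_imbalance [simp]: "cnj (imbalance N u) = imbalance N u"
  by (simp add: imbalance_def)

lemma walsh_sym_diff_left: "walsh (sym_diff u v) A = walsh u A * walsh v A"
  by (simp add: walsh_def sg_sym_diff prod.distrib)

lemma walsh_sym_diff_right:
  "finite A \<Longrightarrow> finite B \<Longrightarrow> finite u \<Longrightarrow> walsh u (sym_diff A B) = walsh u A * walsh u B"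
  using walsh_sym_diff_left[of A B u] walsh_commute[of "sym_diff A B" u] walsh_commute[of A u]
    walsh_commute[of B u] by simp

lemma even_card_sym_diff:
  assumes "finite A" "finite B"
  shows "even (card (sym_diff A B)) \<longleftrightarrow> (even (card A) \<longleftrightarrow> even (card B))"
proof -
  have "card A = card (A - B) + card (A \<inter> B)" "card B = card (B - A) + card (A \<inter> B)"
    using card_Int_Diff[OF assms(1), of B] card_Int_Diff[OF assms(2), of A]
    by (simp_all add: Int_commute)
  moreover have "card (sym_diff A B) = card (A - B) + card (B - A)"
    using assms by (intro card_Un_disjoint) auto
  ultimately show ?thesis by presburger
qed

lemma bij_betw_sym_diff: "A \<subseteq> N \<Longrightarrow> bij_betw (sym_diff A) (Pow N) (Pow N)"
  by (rule bij_betwI[where g = "sym_diff A"]) auto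

text \<open>Exchanging \<open>u\<close> and \<open>A\<close> makes the summation variable the index
  set of the product, so the sum factors as the product of \<open>sg A i + 1\<close>; any
  \<open>i\<close> in \<open>A\<close> gives a zero factor.\<close>

lemma sum_walsh:
  assumes "finite N" "A \<subseteq> N"
  shows "(\<Sum>u\<in>Pow N. walsh u A) = (if A = {} then 2 ^ card N else 0)"
proof -
  have "(\<Sum>u\<in>Pow N. walsh u A) = (\<Sum>u\<in>Pow N. walsh A u)"
    using assms by (intro sum.cong) (auto intro!: walsh_commute dest: finite_subset)
  also have "\<dots> = (\<Prod>i\<in>N. sg A i + 1)"
    using assms(1) by (simp add: prod_add walsh_def)
  also have "\<dots> = (if A = {} then 2 ^ card N else 0)"
  proof (cases "A = {}")
    case False
    then obtain i where "i \<in> A" by blast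
    then have "i \<in> N" "sg A i + 1 = 0" using assms(2) by (auto simp: sg_def)
    then show ?thesis using False assms(1) by (auto simp: prod_zero_iff)
  qed (simp add: sg_def)
  finally show ?thesis .
qed

lemma walsh_orthogonal:
  assumes "finite N" "A \<subseteq> N" "B \<subseteq> N"
  shows "(\<Sum>u\<in>Pow N. walsh u A * walsh u B) = (if A = B then 2 ^ card N else 0)"
proof -
  have "(\<Sum>u\<in>Pow N. walsh u A * walsh u B) = (\<Sum>u\<in>Pow N. walsh u (sym_diff A B))"
    using assms by (intro sum.cong refl, subst walsh_sym_diff_right) (auto dest: finite_subset)
  also have "\<dots> = (if sym_diff A B = {} then 2 ^ card N else 0)"
    using assms by (intro sum_walsh) auto
  also have "sym_diff A B = {} \<longleftrightarrow> A = B" by auto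
  finally show ?thesis .
qed

lemma walsh_orthogonal':
  assumes "finite N" "u \<subseteq> N" "v \<subseteq> N"
  shows "(\<Sum>A\<in>Pow N. walsh u A * walsh v A) = (if u = v then 2 ^ card N else 0)"
proof -
  have "(\<Sum>A\<in>Pow N. walsh u A * walsh v A) = (\<Sum>A\<in>Pow N. walsh A u * walsh A v)"
  proof (intro sum.cong refl)
    fix A assume "A \<in> Pow N"
    then show "walsh u A * walsh v A = walsh A u * walsh A v"
      using assms walsh_commute[of A u] walsh_commute[of A v] by (simp add: finite_subset)
  qed
  then show ?thesis using walsh_orthogonal[OF assms] by simp
qed

lemma sum_walsh':
  assumes "finite N" "u \<subseteq> N"
  shows "(\<Sum>A\<in>Pow N. walsh u A) = (if u = {} then 2 ^ card N else 0)"
  using walsh_orthogonal'[OF assms(1), of "{}" u] assms(2)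
  by (simp add: walsh_def sg_def eq_commute)

text \<open>Since \<open>walsh N C\<close> is the sign of the parity of \<open>C\<close>, the weight
  is the indicator of even cardinality.\<close>

lemma sum_even_card:
  assumes "finite N"
  shows "(\<Sum>C | C \<subseteq> N \<and> even (card C). f C)
    = (\<Sum>C\<in>Pow N. (1 + walsh N C) / 2 * f C)"
proof -
  have "(\<Sum>C\<in>Pow N. (1 + walsh N C) / 2 * f C)
      = (\<Sum>C\<in>Pow N. if even (card C) then f C else 0)"
    using assms by (intro sum.cong) (auto simp: walsh_self)
  also have "\<dots> = (\<Sum>C | C \<subseteq> N \<and> even (card C). f C)"
    using assms by (simp add: sum.If_cases Int_def)
  finally show ?thesis ..
qed

lemma card_even_subsets:
  assumes "finite N" "N \<noteq> {}"
  shows "card {C. C \<subseteq> N \<and> even (card C)} = 2 ^ (card N - 1)"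
proof -
  have "complex_of_nat (card {C. C \<subseteq> N \<and> even (card C)}) = (\<Sum>C\<in>Pow N. (1 + walsh N C) / 2)"
    using sum_even_card[OF assms(1), of "\<lambda>_. 1"] by simp
  also have "\<dots> = 2 ^ card N / 2"
    using assms sum_walsh'[of N N]
    by (simp add: sum.distrib card_Pow flip: sum_divide_distrib)
  also have "\<dots> = of_nat (2 ^ (card N - 1))"
    using assms by (cases "card N") auto
  finally show ?thesis using of_nat_eq_iff by blast
qed

section \<open>Sums of signs and their exponentials\<close>

lemma imbalance_eq:
  assumes "finite N" "u \<subseteq> N"
  shows "imbalance N u = of_int (int (card N) - 2 * int (card u))"
proof -
  have "card N = card (N - u) + card u"
    using assms by (simp add: card_Diff_subset card_mono finite_subset)
  moreover have "imbalance N u = of_nat (card (N - u)) - of_nat (card u)"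
    unfolding imbalance_def sg_def using assms
    by (subst sum.If_cases) (auto simp: Int_absorb1 Diff_eq)
  ultimately show ?thesis by simp
qed

lemma sum_card_2_insert:
  assumes "finite N" "x \<notin> N"
  shows "(\<Sum>D | D \<subseteq> insert x N \<and> card D = 2. f D)
    = (\<Sum>D | D \<subseteq> N \<and> card D = 2. f D) + (\<Sum>i\<in>N. f {x, i})"
proof -
  have "{D. D \<subseteq> insert x N \<and> card D = 2} = {D. D \<subseteq> N \<and> card D = 2} \<union> (\<lambda>i. {x, i}) ` N"
    using assms(2) by (auto simp: card_2_iff doubleton_eq_iff)
  moreover have "inj_on (\<lambda>i. {x, i}) N"
    by (auto simp: inj_on_def doubleton_eq_iff)
  moreover have "{D. D \<subseteq> N \<and> card D = 2} \<inter> (\<lambda>i. {x, i}) ` N = {}"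
    using assms(2) by auto
  moreover have "finite {D. D \<subseteq> N \<and> card D = 2}"
    using assms(1) by simp
  ultimately show ?thesis
    using assms(1) by (simp add: sum.union_disjoint sum.reindex)
qed

text \<open>The left side is the second elementary symmetric function of the signs. As each sign
  squares to 1, the squared sum of the signs is \<open>card N\<close> plus twice this
  function.\<close>

lemma sum_walsh_card_2:
  assumes "finite N"
  shows "(\<Sum>D | D \<subseteq> N \<and> card D = 2. walsh u D) = ((imbalance N u)\<^sup>2 - of_nat (card N)) / 2"
  using assms
proof (induction N rule: finite_induct)
  case empty
  have "{D. D = {} \<and> card D = 2} = ({} :: 'a set set)" by auto
  then show ?case by (simp only: subset_empty imbalance_def) simp
next
  case (insert x N)
  have "(\<Sum>i\<in>N. walsh u {x, i}) = (\<Sum>i\<in>N. sg u x * sg u i)"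
  proof (intro sum.cong refl)
    fix i assume "i \<in> N"
    then have "x \<noteq> i" using insert.hyps by blast
    then show "walsh u {x, i} = sg u x * sg u i" by (simp add: walsh_def)
  qed
  also have "\<dots> = sg u x * imbalance N u"
    by (simp add: imbalance_def sum_distrib_left)
  finally have "(\<Sum>i\<in>N. walsh u {x, i}) = sg u x * imbalance N u" .
  moreover have "imbalance (insert x N) u = sg u x + imbalance N u"
    using insert.hyps by (simp add: imbalance_def)
  moreover have "(sg u x)\<^sup>2 = 1"
    by (simp add: sg_def)
  ultimately show ?case
    using insert by (simp add: sum_card_2_insert power2_sum field_simps)
qed

text \<open>The summand is a product over the coordinates, so the sum over \<open>u\<close> factors:
  each coordinate contributes its term for \<open>i\<close> outside \<open>u\<close> plus its term
  for \<open>i\<close> in \<open>u\<close>, and the latter changes sign when \<open>i\<close> is in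
  \<open>C\<close>.\<close>

lemma sum_walsh_exp_imbalance:
  assumes "finite N" "C \<subseteq> N"
  shows "(\<Sum>u\<in>Pow N. walsh u C * exp (z * imbalance N u))
    = (exp z - exp (- z)) ^ card C * (exp z + exp (- z)) ^ (card N - card C)"
proof -
  have "walsh u C * exp (z * imbalance N u)
      = (\<Prod>i\<in>u. sg C i * exp (- z)) * (\<Prod>i\<in>N - u. exp z)" if "u \<subseteq> N" for u
  proof -
    have u: "finite u" "finite C" using that assms finite_subset by auto
    have "exp (z * imbalance N u) = (\<Prod>i\<in>N. exp (z * sg u i))"
      using assms(1) by (simp add: imbalance_def exp_sum sum_distrib_left)
    also have "\<dots> = (\<Prod>i\<in>N - u. exp (z * sg u i)) * (\<Prod>i\<in>u. exp (z * sg u i))"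
      using prod.subset_diff[OF that assms(1)] by blast
    also have "\<dots> = (\<Prod>i\<in>N - u. exp z) * (\<Prod>i\<in>u. exp (- z))"
      by (simp add: sg_def)
    finally show ?thesis
      using walsh_commute[OF u(2,1)] by (simp add: walsh_def prod.distrib)
  qed
  then have "(\<Sum>u\<in>Pow N. walsh u C * exp (z * imbalance N u))
      = (\<Sum>u\<in>Pow N. (\<Prod>i\<in>u. sg C i * exp (- z)) * (\<Prod>i\<in>N - u. exp z))"
    by (intro sum.cong) auto
  also have "\<dots> = (\<Prod>i\<in>N. sg C i * exp (- z) + exp z)"
    using assms(1) by (simp add: prod_add)
  also have "\<dots> = (\<Prod>i\<in>N. if i \<in> C then exp z - exp (- z) else exp z + exp (- z))"
    by (intro prod.cong) (auto simp: sg_def)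
  also have "\<dots> = (exp z - exp (- z)) ^ card C * (exp z + exp (- z)) ^ card (N - C)"
    using assms by (subst prod.If_cases) (auto simp: Int_absorb1 Diff_eq)
  finally show ?thesis
    using assms by (simp add: card_Diff_subset finite_subset)
qed

section \<open>Flatness of the transformed quadratic phase\<close>

text \<open>
  With \<open>N = {..<n}\<close>, this is the eigenvalue of the transition matrix at time \<open>\<tau>\<close> on the Walsh
  function of \<open>u\<close>, up to the factor \<open>exp (i \<tau> n / 2)\<close>, which does not depend on \<open>u\<close>.
\<close>

definition phase :: "'a set \<Rightarrow> real \<Rightarrow> 'a set \<Rightarrow> complex" where
  "phase N \<tau> u = exp (- \<i> * of_real \<tau> / 2 * (imbalance N u)\<^sup>2)"

definition walsh_transform :: "'a set \<Rightarrow> ('a set \<Rightarrow> complex) \<Rightarrow> 'a set \<Rightarrow> complex" where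
  "walsh_transform N f C = (\<Sum>u\<in>Pow N. walsh u C * f u)"

text \<open>A Wiener-Khinchin identity: the transform of the power spectrum is the autocorrelation.
  Expanding the square and summing over \<open>C\<close> first, orthogonality leaves only
  \<open>u' = sym_diff v u\<close>.\<close>

lemma sum_walsh_norm_walsh_transform:
  assumes "finite N" "v \<subseteq> N"
  shows "(\<Sum>C\<in>Pow N. walsh v C * of_real ((norm (walsh_transform N f C))\<^sup>2))
    = 2 ^ card N * (\<Sum>u\<in>Pow N. f u * cnj (f (sym_diff v u)))"
proof -
  have "(\<Sum>C\<in>Pow N. walsh v C * of_real ((norm (walsh_transform N f C))\<^sup>2))
      = (\<Sum>C\<in>Pow N. \<Sum>u\<in>Pow N. \<Sum>u'\<in>Pow N.
          f u * cnj (f u') * (walsh (sym_diff v u) C * walsh u' C))"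
    unfolding complex_norm_square walsh_transform_def walsh_sym_diff_left cnj_sum sum_product
    by (simp add: sum_distrib_left mult_ac)
  also have "\<dots> = (\<Sum>u\<in>Pow N. \<Sum>C\<in>Pow N. \<Sum>u'\<in>Pow N.
          f u * cnj (f u') * (walsh (sym_diff v u) C * walsh u' C))"
    by (rule sum.swap)
  also have "\<dots> = (\<Sum>u\<in>Pow N. \<Sum>u'\<in>Pow N. \<Sum>C\<in>Pow N.
          f u * cnj (f u') * (walsh (sym_diff v u) C * walsh u' C))"
    by (intro sum.cong refl sum.swap)
  also have "\<dots> = (\<Sum>u\<in>Pow N. \<Sum>u'\<in>Pow N.
          f u * cnj (f u') * (if sym_diff v u = u' then 2 ^ card N else 0))"
    unfolding sum_distrib_left[symmetric]
  proof (intro sum.cong refl)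
    fix u u' assume "u \<in> Pow N" "u' \<in> Pow N"
    then show "f u * cnj (f u') * (\<Sum>C\<in>Pow N. walsh (sym_diff v u) C * walsh u' C)
      = f u * cnj (f u') * (if sym_diff v u = u' then 2 ^ card N else 0)"
      using assms by (subst walsh_orthogonal') auto
  qed
  also have "\<dots> = (\<Sum>u\<in>Pow N. f u * cnj (f (sym_diff v u)) * 2 ^ card N)"
  proof (intro sum.cong refl)
    fix u assume "u \<in> Pow N"
    then have "sym_diff v u \<in> Pow N" using assms(2) by auto
    then show "(\<Sum>u'\<in>Pow N. f u * cnj (f u') * (if sym_diff v u = u' then 2 ^ card N else 0))
      = f u * cnj (f (sym_diff v u)) * 2 ^ card N"
      using assms(1) by (simp add: if_distrib sum.delta' cong: if_cong)
  qed
  finally show ?thesis by (simp add: sum_distrib_left mult_ac)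
qed

section \<open>Autocorrelation of the phase and the case of an even number of coordinates\<close>

lemma imbalance_sym_diff_self:
  "imbalance v (sym_diff v u) = - imbalance v u"
  unfolding imbalance_def sum_negf[symmetric] by (intro sum.cong) (auto simp: sg_def)

lemma imbalance_sym_diff_disjoint:
  "v \<inter> R = {} \<Longrightarrow> imbalance R (sym_diff v u) = imbalance R u"
  unfolding imbalance_def by (intro sum.cong) (auto simp: sg_def)

lemma imbalance_union:
  "finite v \<Longrightarrow> finite R \<Longrightarrow> v \<inter> R = {} \<Longrightarrow> imbalance (v \<union> R) u = imbalance v u + imbalance R u"
  by (simp add: imbalance_def sum.union_disjoint)

text \<open>With \<open>p\<close> and \<open>r\<close> the imbalances on \<open>v\<close> and
  \<open>R\<close>, flipping \<open>v\<close> turns \<open>p + r\<close> into \<open>r - p\<close>.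
  The difference of the squares is \<open>4 * p * r\<close>, so the quadratic exponent becomes
  bilinear.\<close>

lemma phase_mult_cnj:
  assumes "finite v" "finite R" "v \<inter> R = {}"
  shows "phase (v \<union> R) \<tau> u * cnj (phase (v \<union> R) \<tau> (sym_diff v u))
    = exp (- 2 * \<i> * of_real \<tau> * imbalance v u * imbalance R u)"
proof -
  have 1: "imbalance (v \<union> R) (sym_diff v u) = imbalance R u - imbalance v u"
    unfolding imbalance_union[OF assms] imbalance_sym_diff_disjoint[OF assms(3)]
      imbalance_sym_diff_self by simp
  show ?thesis
    unfolding phase_def 1
    unfolding imbalance_union[OF assms] exp_cnj exp_add[symmetric]
    by (intro arg_cong[where f = exp]) (simp add: power2_eq_square field_simps)
qed

text \<open>Complementing \<open>u\<close> negates the imbalance and so preserves the phase, but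
  changes the sign of \<open>walsh u C\<close>; the sum equals its own negative.\<close>

lemma walsh_transform_phase_odd:
  assumes "finite N" "C \<subseteq> N" "odd (card C)"
  shows "walsh_transform N (phase N \<tau>) C = 0"
proof -
  have "walsh_transform N (phase N \<tau>) C
      = (\<Sum>u\<in>Pow N. walsh (sym_diff N u) C * phase N \<tau> (sym_diff N u))"
    unfolding walsh_transform_def
    using sum.reindex_bij_betw[OF bij_betw_sym_diff[of N N], of "\<lambda>u. walsh u C * phase N \<tau> u"]
    by simp
  also have "\<dots> = (\<Sum>u\<in>Pow N. - (walsh u C * phase N \<tau> u))"
  proof (intro sum.cong refl)
    fix u
    have "walsh N C = -1"
      using assms by (simp add: walsh_eq finite_subset Int_absorb1)
    moreover have "phase N \<tau> (sym_diff N u) = phase N \<tau> u"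
      using imbalance_sym_diff_self[of N u] unfolding phase_def by simp
    ultimately show "walsh (sym_diff N u) C * phase N \<tau> (sym_diff N u) = - (walsh u C * phase N \<tau> u)"
      unfolding walsh_sym_diff_left by simp
  qed
  also have "\<dots> = - walsh_transform N (phase N \<tau>) C"
    by (simp add: walsh_transform_def sum_negf)
  finally show ?thesis by simp
qed

text \<open>The power spectrum is constant on even sets and 0 on odd ones, that is,
  \<open>2 ^ card N * (1 + walsh N C)\<close>. Being a combination of the characters of
  \<open>{}\<close> and \<open>N\<close>, it is orthogonal to that of every other
  \<open>v\<close>.\<close>

lemma phase_autocorrelation_eq_0:
  assumes "finite N" "v \<subseteq> N" "v \<noteq> {}" "v \<noteq> N"
    and flat: "\<And>C. C \<subseteq> N \<Longrightarrow> even (card C) \<Longrightarrow>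
      (norm (walsh_transform N (phase N \<tau>) C))\<^sup>2 = 2 ^ (card N + 1)"
  shows "(\<Sum>u\<in>Pow N. phase N \<tau> u * cnj (phase N \<tau> (sym_diff v u))) = 0"
proof -
  have "(\<Sum>C\<in>Pow N. walsh v C * of_real ((norm (walsh_transform N (phase N \<tau>) C))\<^sup>2))
      = (\<Sum>C\<in>Pow N. 2 ^ card N * (walsh v C + walsh v C * walsh N C))"
  proof (intro sum.cong refl)
    fix C assume C: "C \<in> Pow N"
    then have "walsh N C = (-1) ^ card C"
      using assms(1) by (auto simp: walsh_self walsh_eq finite_subset Int_absorb1)
    then show "walsh v C * of_real ((norm (walsh_transform N (phase N \<tau>) C))\<^sup>2)
        = 2 ^ card N * (walsh v C + walsh v C * walsh N C)"
      using C flat[of C] walsh_transform_phase_odd[OF assms(1), of C \<tau>]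
      by (cases "even (card C)") auto
  qed
  also have "\<dots> = 0"
    using assms by (simp add: sum.distrib sum_walsh' walsh_orthogonal' flip: sum_distrib_left)
  finally show ?thesis
    using sum_walsh_norm_walsh_transform[OF assms(1,2), of "phase N \<tau>"] by simp
qed

lemma sum_Pow_insert:
  fixes f :: "'a set \<Rightarrow> 'b :: comm_monoid_add"
  assumes "finite R" "x \<notin> R"
  shows "(\<Sum>u\<in>Pow (insert x R). f u) = (\<Sum>u\<in>Pow R. f u + f (insert x u))"
proof -
  have "inj_on (insert x) (Pow R)"
    using assms(2) by (auto simp: inj_on_def)
  then show ?thesis
    using assms unfolding Pow_insert
    by (subst sum.union_disjoint) (auto simp: sum.reindex sum.distrib)
qed

lemma exp_double_eq_neg_1:
  assumes "finite N" "card N \<ge> 2"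
    and flat: "\<And>C. C \<subseteq> N \<Longrightarrow> even (card C) \<Longrightarrow>
      (norm (walsh_transform N (phase N \<tau>) C))\<^sup>2 = 2 ^ (card N + 1)"
  shows "exp (4 * \<i> * of_real \<tau>) = -1"
proof -
  obtain x where x: "x \<in> N" using assms(2) by fastforce
  define R where "R = N - {x}"
  have R: "finite R" "x \<notin> R" "N = {x} \<union> R"
    using x assms(1) by (auto simp: R_def)
  have "{x} \<noteq> N" using assms(2) by auto
  then have "0 = (\<Sum>u\<in>Pow N. phase N \<tau> u * cnj (phase N \<tau> (sym_diff {x} u)))"
    using phase_autocorrelation_eq_0[OF assms(1), of "{x}" \<tau>] flat x by auto
  also have "\<dots> = (\<Sum>u\<in>Pow N. exp (- 2 * \<i> * of_real \<tau> * sg u x * imbalance R u))"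
  proof (intro sum.cong refl)
    fix u
    show "phase N \<tau> u * cnj (phase N \<tau> (sym_diff {x} u))
        = exp (- 2 * \<i> * of_real \<tau> * sg u x * imbalance R u)"
      using phase_mult_cnj[of "{x}" R \<tau> u] R unfolding R(3) by (simp add: imbalance_def)
  qed
  \<comment> \<open>Pairing \<open>u\<close> with \<open>insert x u\<close> flips only the sign at
    \<open>x\<close>, which gives two opposite exponents.\<close>
  also have "\<dots> = (\<Sum>u\<in>Pow R. exp (- 2 * \<i> * of_real \<tau> * imbalance R u)
      + exp (2 * \<i> * of_real \<tau> * imbalance R u))"
  proof -
    have "sg u x = 1" "sg (insert x u) x = -1" "imbalance R (insert x u) = imbalance R u"
      if "u \<in> Pow R" for u
      using that R(2) by (auto simp: sg_def imbalance_def intro!: sum.cong)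
    then show ?thesis
      using R by (simp add: sum_Pow_insert)
  qed
  also have "\<dots> = 2 * (exp (2 * \<i> * of_real \<tau>) + exp (- (2 * \<i> * of_real \<tau>))) ^ card R"
    using sum_walsh_exp_imbalance[OF R(1), of "{}" "2 * \<i> * of_real \<tau>"]
      sum_walsh_exp_imbalance[OF R(1), of "{}" "- (2 * \<i> * of_real \<tau>)"]
    by (simp add: sum.distrib walsh_def add.commute)
  finally have "exp (2 * \<i> * of_real \<tau>) + exp (- (2 * \<i> * of_real \<tau>)) = 0"
    by simp
  \<comment> \<open>Multiplying by \<open>exp (2 * \<i> * of_real \<tau>)\<close> turns the
    vanishing cosine into a statement about a single exponential.\<close>
  then have "exp (2 * \<i> * of_real \<tau>) * (exp (2 * \<i> * of_real \<tau>) + exp (- (2 * \<i> * of_real \<tau>))) = 0"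
    by simp
  then have "exp (4 * \<i> * of_real \<tau>) + 1 = 0"
    unfolding distrib_left exp_add[symmetric] by (simp add: algebra_simps)
  then show ?thesis
    by (simp add: eq_neg_iff_add_eq_0)
qed

lemma exp_mult_of_int_eq_1: "exp z = 1 \<Longrightarrow> exp (of_int m * z) = (1 :: complex)"
  by (simp add: exp_eq_1)
     (metis (no_types, opaque_lifting) mult.assoc mult.commute mult.left_commute of_int_mult)

text \<open>For a pair \<open>v\<close>, both \<open>v\<close> and its complement \<open>R\<close>
  have even size, hence even imbalances. The bilinear exponent is then an integer multiple of
  \<open>8 * \<i> * of_real \<tau>\<close>, whose exponential is 1, so the autocorrelation at
  \<open>v\<close> is \<open>2 ^ card N\<close> instead of 0.\<close>

lemma not_flat_even:
  assumes "finite N" "card N \<ge> 3" "even (card N)"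
  shows "\<exists>C\<subseteq>N. even (card C) \<and>
      (norm (walsh_transform N (phase N \<tau>) C))\<^sup>2 \<noteq> 2 ^ (card N + 1)"
proof (rule ccontr)
  assume "\<not> ?thesis"
  then have flat: "(norm (walsh_transform N (phase N \<tau>) C))\<^sup>2 = 2 ^ (card N + 1)"
    if "C \<subseteq> N" "even (card C)" for C using that by blast
  have "exp (4 * \<i> * of_real \<tau>) = -1"
    using exp_double_eq_neg_1[OF assms(1)] assms(2) flat by auto
  then have exp8: "exp (8 * \<i> * of_real \<tau>) = 1"
    using exp_double[of "4 * \<i> * of_real \<tau>"] by (simp add: mult.assoc)
  obtain v where v: "v \<subseteq> N" "card v = 2"
    using assms(2) obtain_subset_with_card_n[of 2 N] by auto
  then obtain x y where xy: "v = {x, y}" "x \<noteq> y"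
    by (auto simp: card_2_iff)
  define R where "R = N - v"
  have R: "finite R" "finite v" "v \<inter> R = {}" "N = v \<union> R"
    using v assms(1) by (auto simp: R_def finite_subset)
  have "even (card R)"
    using assms v by (simp add: R_def card_Diff_subset finite_subset)
  have "phase N \<tau> u * cnj (phase N \<tau> (sym_diff v u)) = 1" if "u \<in> Pow N" for u
  proof -
    obtain s where s: "imbalance v u = of_int (2 * s)"
    proof
      show "imbalance v u = of_int (2 * (1 - (if x \<in> u then 1 else 0) - (if y \<in> u then 1 else 0)))"
        using xy by (simp add: imbalance_def sg_def)
    qed
    \<comment> \<open>\<open>u\<close> need not lie inside \<open>R\<close>, as
      \<open>imbalance_eq\<close> demands; only its trace on \<open>R\<close> matters.\<close>
    have "imbalance R u = imbalance R (R \<inter> u)"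
      by (simp add: imbalance_def sg_def)
    also have "\<dots> = of_int (int (card R) - 2 * int (card (R \<inter> u)))"
      using R(1) by (intro imbalance_eq) auto
    finally have 1: "imbalance R u = of_int (int (card R) - 2 * int (card (R \<inter> u)))" .
    have "even (int (card R) - 2 * int (card (R \<inter> u)))"
      using \<open>even (card R)\<close> by simp
    then obtain t where t: "imbalance R u = of_int (2 * t)"
      using 1 by (metis evenE)
    have "- 2 * \<i> * of_real \<tau> * imbalance v u * imbalance R u
        = of_int (- s * t) * (8 * \<i> * of_real \<tau>)"
      by (simp add: s t)
    then show ?thesis
      unfolding R(4) phase_mult_cnj[OF R(2,1,3)] using exp_mult_of_int_eq_1[OF exp8] by metis
  qed
  then have "(\<Sum>u\<in>Pow N. phase N \<tau> u * cnj (phase N \<tau> (sym_diff v u))) = 2 ^ card N"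
    using assms(1) by (simp add: card_Pow)
  moreover have "v \<noteq> {}" "v \<noteq> N"
    using v(2) assms(2) by auto
  ultimately show False
    using phase_autocorrelation_eq_0[OF assms(1) v(1), of \<tau>] flat by simp
qed

section \<open>Flatness at time \<pi>/4 for an odd number of coordinates\<close>

text \<open>Modulo 16, the square of an odd \<open>m\<close> is 1 if \<open>m\<close> is 1 or -1
  modulo 8, and 9 otherwise. Hence the left side is \<open>exp (- \<i> * of_real pi / 8)\<close> up
  to a sign, which is that of cos(\<pi> m / 4).\<close>

lemma exp_square_odd:
  assumes "odd m"
  shows "exp (- \<i> * of_real (pi / 4) / 2 * (of_int m)\<^sup>2) =
    exp (- \<i> * of_real pi / 8) / of_real (sqrt 2) *
      (exp (\<i> * of_real pi / 4 * of_int m) + exp (- (\<i> * of_real pi / 4) * of_int m))"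
proof -
  have *: ?thesis if "m = 4 * j + e" "e = 1 \<or> e = - 1" for j e
  proof -
    \<comment> \<open>\<open>E\<close> is the sign (-1)^j. It comes out of the left side because
      \<open>m^2 = 16 * j^2 + 8 * e * j + 1\<close>, and out of both exponentials on the right;
      being its own inverse, it absorbs the sign of \<open>e\<close>.\<close>
    define E where "E = exp (\<i> * of_real pi * of_int j)"
    have "E * E = exp (of_int j * (2 * \<i> * of_real pi))"
      unfolding E_def exp_add[symmetric] by (simp add: algebra_simps)
    also have "\<dots> = 1" by (rule exp_mult_of_int_eq_1) (simp add: exp_eq_1)
    finally have EE: "E * E = 1" .
    have E': "exp (- (\<i> * of_real pi * of_int j)) = E"
      using EE unfolding exp_minus E_def by (metis inverse_unique)
    have Ee: "exp (\<i> * of_real pi * of_int (- e * j)) = E"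
      using that(2) E' by (auto simp: E_def)
    have "- \<i> * of_real (pi / 4) / 2 * (of_int m)\<^sup>2
        = - \<i> * of_real pi / 8 + \<i> * of_real pi * of_int (- e * j)
          + of_int (- (j * j)) * (2 * \<i> * of_real pi)"
      using that by (auto simp: power2_eq_square field_simps)
    then have L: "exp (- \<i> * of_real (pi / 4) / 2 * (of_int m)\<^sup>2) = exp (- \<i> * of_real pi / 8) * E"
      using exp_mult_of_int_eq_1[OF exp_two_pi_i', of "- (j * j)"] Ee
      by (simp only: exp_add mult_1_left mult_1_right mult_ac)
    have "\<i> * of_real pi / 4 * of_int m = \<i> * of_real pi * of_int j + of_int e * (\<i> * of_real pi / 4)"
      using that by (auto simp: field_simps)
    then have P: "exp (\<i> * of_real pi / 4 * of_int m) = E * exp (of_int e * (\<i> * of_real pi / 4))"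
      by (simp only: exp_add E_def)
    have "- (\<i> * of_real pi / 4) * of_int m
        = - (\<i> * of_real pi * of_int j) + of_int (- e) * (\<i> * of_real pi / 4)"
      using that by (auto simp: field_simps)
    then have M: "exp (- (\<i> * of_real pi / 4) * of_int m)
        = E * exp (of_int (- e) * (\<i> * of_real pi / 4))"
      by (simp only: exp_add E')
    have "exp (\<i> * of_real pi / 4) + exp (- (\<i> * of_real pi / 4)) = of_real (sqrt 2)"
      using cis_conv_exp[of "pi / 4"] cis_conv_exp[of "- (pi / 4)"]
      by (simp add: complex_eq_iff cos_45 sin_45)
    then have "exp (of_int e * (\<i> * of_real pi / 4)) + exp (of_int (- e) * (\<i> * of_real pi / 4))
        = of_real (sqrt 2)"
      using that(2) by (auto simp: add.commute)
    then show ?thesis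
      unfolding L P M distrib_left[symmetric] by simp
  qed
  have "m mod 4 = 1 \<or> m mod 4 = 3"
    using assms by presburger
  then have "m = 4 * (m div 4) + 1 \<or> m = 4 * (m div 4 + 1) + (- 1)"
    by presburger
  then show ?thesis using *[of "m div 4" 1] *[of "m div 4 + 1" "-1"] by blast
qed

text \<open>The phase splits into two exponentials with factorising transforms. The factors have
  modulus \<open>sqrt 2\<close> whether or not the coordinate lies in \<open>C\<close>, so the size
  of \<open>C\<close> does not affect the modulus; evenness of \<open>card C\<close> makes the two
  transforms equal rather than opposite.\<close>

lemma flat_odd:
  assumes "finite N" "odd (card N)" "C \<subseteq> N" "even (card C)"
  shows "(norm (walsh_transform N (phase N (pi / 4)) C))\<^sup>2 = 2 ^ (card N + 1)"
proof -
  define z where "z = \<i> * complex_of_real pi / 4"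
  define c where "c = exp (- \<i> * of_real pi / 8) / of_real (sqrt 2)"
  have phase: "phase N (pi / 4) u = c * (exp (z * imbalance N u) + exp (- z * imbalance N u))"
    if "u \<in> Pow N" for u
    using that exp_square_odd[of "int (card N) - 2 * int (card u)"] assms(1,2)
    unfolding phase_def z_def c_def by (simp add: imbalance_eq)
  have cos_sin: "exp z + exp (- z) = of_real (sqrt 2)" "exp z - exp (- z) = \<i> * of_real (sqrt 2)"
    using cis_conv_exp[of "pi / 4"] cis_conv_exp[of "- (pi / 4)"]
    by (simp_all add: z_def complex_eq_iff cos_45 sin_45)
  then have cos_sin': "exp (- z) + exp z = of_real (sqrt 2)" "exp (- z) - exp z = - (\<i> * of_real (sqrt 2))"
    by (simp_all add: algebra_simps)
  have "walsh_transform N (phase N (pi / 4)) C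
      = c * (\<Sum>u\<in>Pow N. walsh u C * exp (z * imbalance N u))
        + c * (\<Sum>u\<in>Pow N. walsh u C * exp (- z * imbalance N u))"
    unfolding walsh_transform_def sum_distrib_left sum.distrib[symmetric]
    by (intro sum.cong refl) (simp add: phase algebra_simps)
  also have "\<dots> = 2 * c * (\<i> * of_real (sqrt 2)) ^ card C * of_real (sqrt 2) ^ (card N - card C)"
    using sum_walsh_exp_imbalance[OF assms(1,3), of z] sum_walsh_exp_imbalance[OF assms(1,3), of "- z"]
      assms(4) by (simp add: cos_sin cos_sin')
  finally have "norm (walsh_transform N (phase N (pi / 4)) C)
      = 2 * norm c * (sqrt 2 ^ card C * sqrt 2 ^ (card N - card C))"
    by (simp add: norm_mult norm_power)
  also have "sqrt 2 ^ card C * sqrt 2 ^ (card N - card C) = sqrt 2 ^ card N"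
    using assms by (simp add: card_mono flip: power_add)
  also have "norm c = 1 / sqrt 2"
    by (simp add: c_def norm_divide)
  finally show ?thesis
    by (simp add: power_mult_distrib power_divide flip: power_mult)
       (simp add: mult.commute[of _ 2] power_mult)
qed

section \<open>The halved cube\<close>

definition support :: "bool list \<Rightarrow> nat set" where
  "support w = {i. i < length w \<and> w ! i}"

definition eigenvalue :: "nat \<Rightarrow> nat set \<Rightarrow> complex" where
  "eigenvalue n u = ((imbalance {..<n} u)\<^sup>2 - of_nat n) / 2"

lemma bij_betw_support: "bij_betw support {w. length w = n} (Pow {..<n})"
proof (rule bij_betwI[where g = "\<lambda>A. map (\<lambda>i. i \<in> A) [0..<n]"])
qed (auto simp: support_def intro!: nth_equalityI)

lemma hamming_weight_eq: "hamming_weight w = card (support w)"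
  by (simp add: hamming_weight_def support_def)

lemma hamming_dist_eq:
  "length v = length w \<Longrightarrow> hamming_dist v w = card (sym_diff (support v) (support w))"
  unfolding hamming_dist_def support_def by (intro arg_cong[of _ _ card]) auto

lemma bij_betw_support_halved_cube:
  "bij_betw support (pverts (halved_cube n)) {C. C \<subseteq> {..<n} \<and> even (card C)}"
proof -
  have "pverts (halved_cube n) \<subseteq> {w. length w = n}"
    by (auto simp: halved_cube_def)
  then have "inj_on support (pverts (halved_cube n))"
    using bij_betw_support[of n] by (auto simp: bij_betw_def inj_on_subset)
  moreover have "support ` pverts (halved_cube n) = {C. C \<subseteq> {..<n} \<and> even (card C)}"
  proof (intro equalityI subsetI)
    fix C assume "C \<in> {C. C \<subseteq> {..<n} \<and> even (card C)}"
    moreover from this obtain w where "length w = n" "C = support w"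
      using bij_betw_imp_surj_on[OF bij_betw_support[of n]] by blast
    ultimately show "C \<in> support ` pverts (halved_cube n)"
      by (auto simp: halved_cube_def hamming_weight_eq)
  qed (auto simp: halved_cube_def hamming_weight_eq support_def)
  ultimately show ?thesis by (simp add: bij_betw_def)
qed

lemma support_halved_cube:
  "a \<in> pverts (halved_cube n) \<Longrightarrow> support a \<subseteq> {..<n} \<and> even (card (support a))"
  using bij_betw_apply[OF bij_betw_support_halved_cube] by blast

lemma adjacency_matrix_halved_cube:
  assumes "a \<in> pverts (halved_cube n)" "c \<in> pverts (halved_cube n)"
  shows "adjacency_matrix (halved_cube n) a c =
    (if card (sym_diff (support a) (support c)) = 2 then 1 else 0)"
  using assms by (auto simp: adjacency_matrix_def halved_cube_def hamming_dist_eq)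

text \<open>The halved cube is a Cayley graph on the even sets whose connection set consists of the
  pairs, so the eigenvalue of a character is its sum over all pairs.\<close>

lemma adjacency_matrix_walsh:
  assumes a: "a \<in> pverts (halved_cube n)" and u: "u \<subseteq> {..<n}"
  shows "(\<Sum>c\<in>pverts (halved_cube n). adjacency_matrix (halved_cube n) a c * walsh u (support c))
    = eigenvalue n u * walsh u (support a)"
proof -
  define A where "A = support a"
  have A: "A \<subseteq> {..<n}" "even (card A)" "finite A"
    using support_halved_cube[OF a] by (auto simp: A_def finite_subset)
  have fin: "finite u" using u finite_subset by blast
  let ?f = "\<lambda>C. (if card (sym_diff A C) = 2 then 1 else 0) * walsh u C"
  have "(\<Sum>c\<in>pverts (halved_cube n). adjacency_matrix (halved_cube n) a c * walsh u (support c))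
      = (\<Sum>c\<in>pverts (halved_cube n). ?f (support c))"
    using a by (intro sum.cong) (auto simp: adjacency_matrix_halved_cube A_def)
  also have "\<dots> = (\<Sum>C | C \<subseteq> {..<n} \<and> even (card C). ?f C)"
    by (rule sum.reindex_bij_betw[OF bij_betw_support_halved_cube])
  \<comment> \<open>A set that differs from the even set \<open>A\<close> in two points is even, so
    odd sets contribute nothing. On all of \<open>Pow {..<n}\<close> one can then substitute
    \<open>C = sym_diff A D\<close>.\<close>
  also have "\<dots> = (\<Sum>C\<in>Pow {..<n}. ?f C)"
  proof (rule sum.mono_neutral_left)
    show "\<forall>C\<in>Pow {..<n} - {C. C \<subseteq> {..<n} \<and> even (card C)}. ?f C = 0"
    proof
      fix C assume "C \<in> Pow {..<n} - {C. C \<subseteq> {..<n} \<and> even (card C)}"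
      then have "odd (card (sym_diff A C))"
        using A by (subst even_card_sym_diff) (auto simp: finite_subset)
      then have "card (sym_diff A C) \<noteq> 2" by (metis even_numeral)
      then show "?f C = 0" by simp
    qed
  qed auto
  also have "\<dots> = (\<Sum>D\<in>Pow {..<n}. ?f (sym_diff A D))"
    using sum.reindex_bij_betw[OF bij_betw_sym_diff[OF A(1)], of ?f] by simp
  also have "\<dots> = (\<Sum>D\<in>Pow {..<n}. if card D = 2 then walsh u A * walsh u D else 0)"
  proof (intro sum.cong refl)
    fix D assume "D \<in> Pow {..<n}"
    then have "finite D" by (auto simp: finite_subset)
    moreover have "sym_diff A (sym_diff A D) = D" by auto
    ultimately show "?f (sym_diff A D) = (if card D = 2 then walsh u A * walsh u D else 0)"
      using walsh_sym_diff_right[OF A(3) _ fin, of D] by simp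
  qed
  also have "\<dots> = (\<Sum>D | D \<subseteq> {..<n} \<and> card D = 2. walsh u A * walsh u D)"
    by (simp add: sum.If_cases Int_def)
  also have "\<dots> = eigenvalue n u * walsh u A"
    unfolding sum_distrib_left[symmetric]
    using sum_walsh_card_2[of "{..<n}" u] by (simp add: eigenvalue_def)
  finally show ?thesis by (simp add: A_def)
qed

text \<open>Spectral expansion. The characters of \<open>u\<close> and of its complement agree on
  even sets; summing over all \<open>u\<close> with weight \<open>1 / 2 ^ n\<close> avoids choosing
  representatives.\<close>

lemma mat_power_on_halved_cube:
  assumes "a \<in> pverts (halved_cube n)" "b \<in> pverts (halved_cube n)"
  shows "mat_power_on (pverts (halved_cube n)) (\<lambda>a b. z * adjacency_matrix (halved_cube n) a b) k a b
    = (\<Sum>u\<in>Pow {..<n}. (z * eigenvalue n u) ^ k * walsh u (support a) * walsh u (support b)) / 2 ^ n"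
  using assms(1)
proof (induction k arbitrary: a)
  case 0
  have "a = b \<longleftrightarrow> support a = support b"
    using 0 assms(2) bij_betw_support_halved_cube[of n] by (auto simp: bij_betw_def inj_on_def)
  then show ?case
    using walsh_orthogonal[of "{..<n}" "support a" "support b"] support_halved_cube[OF 0]
      support_halved_cube[OF assms(2)] by simp
next
  case (Suc k)
  let ?V = "pverts (halved_cube n)" and ?A = "adjacency_matrix (halved_cube n)"
  have "mat_power_on ?V (\<lambda>a b. z * ?A a b) (Suc k) a b
      = (\<Sum>c\<in>?V. \<Sum>u\<in>Pow {..<n}. z * ?A a c *
          ((z * eigenvalue n u) ^ k * walsh u (support c) * walsh u (support b)) / 2 ^ n)"
    using Suc.IH by (simp add: sum_distrib_left sum_divide_distrib)
  also have "\<dots> = (\<Sum>u\<in>Pow {..<n}. \<Sum>c\<in>?V. z * ?A a c *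
          ((z * eigenvalue n u) ^ k * walsh u (support c) * walsh u (support b)) / 2 ^ n)"
    by (rule sum.swap)
  also have "\<dots> = (\<Sum>u\<in>Pow {..<n}. (\<Sum>c\<in>?V. ?A a c * walsh u (support c)) *
          (z * (z * eigenvalue n u) ^ k * walsh u (support b)) / 2 ^ n)"
    unfolding sum_distrib_right sum_divide_distrib by (simp add: mult_ac)
  also have "\<dots> = (\<Sum>u\<in>Pow {..<n}.
      (z * eigenvalue n u) ^ Suc k * walsh u (support a) * walsh u (support b) / 2 ^ n)"
    by (intro sum.cong refl, simp only: Pow_iff adjacency_matrix_walsh[OF Suc.prems])
       (simp add: mult_ac)
  finally show ?case by (simp add: sum_divide_distrib)
qed

text \<open>The exponential series is summed inside the finite spectral sum. The constant part
  \<open>- n / 2\<close> of the eigenvalue yields the unimodular prefactor, and the two characters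
  merge into that of the symmetric difference.\<close>

lemma transition_matrix_halved_cube:
  assumes "a \<in> pverts (halved_cube n)" "b \<in> pverts (halved_cube n)"
  shows "transition_matrix (halved_cube n) \<tau> a b = exp (\<i> * of_real \<tau> * of_nat n / 2) *
    walsh_transform {..<n} (phase {..<n} \<tau>) (sym_diff (support a) (support b)) / 2 ^ n"
proof -
  let ?z = "- \<i> * of_real \<tau>"
  let ?w = "\<lambda>u. walsh u (support a) * walsh u (support b) / 2 ^ n"
  have "(\<lambda>k. (?z * eigenvalue n u) ^ k / fact k) sums exp (?z * eigenvalue n u)" for u
    using exp_converges[of "?z * eigenvalue n u"] by (simp add: scaleR_conv_of_real field_simps)
  then have "(\<lambda>k. \<Sum>u\<in>Pow {..<n}. (?z * eigenvalue n u) ^ k / fact k * ?w u)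
      sums (\<Sum>u\<in>Pow {..<n}. exp (?z * eigenvalue n u) * ?w u)"
    by (intro sums_sum sums_mult2)
  moreover have "mat_power_on (pverts (halved_cube n))
        (\<lambda>a b. ?z * adjacency_matrix (halved_cube n) a b) k a b / fact k
      = (\<Sum>u\<in>Pow {..<n}. (?z * eigenvalue n u) ^ k / fact k * ?w u)" for k
    unfolding mat_power_on_halved_cube[OF assms]
    by (simp add: sum_divide_distrib field_simps)
  ultimately have "transition_matrix (halved_cube n) \<tau> a b
      = (\<Sum>u\<in>Pow {..<n}. exp (?z * eigenvalue n u) * ?w u)"
    unfolding transition_matrix_def mat_exp_on_def by (simp add: sums_iff)
  also have "\<dots> = (\<Sum>u\<in>Pow {..<n}. exp (\<i> * of_real \<tau> * of_nat n / 2) *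
      (walsh u (sym_diff (support a) (support b)) * phase {..<n} \<tau> u) / 2 ^ n)"
  proof (intro sum.cong refl)
    fix u assume "u \<in> Pow {..<n}"
    then have "walsh u (sym_diff (support a) (support b)) = walsh u (support a) * walsh u (support b)"
      using assms[THEN support_halved_cube] by (intro walsh_sym_diff_right) (auto simp: finite_subset)
    moreover have "exp (?z * eigenvalue n u) = exp (\<i> * of_real \<tau> * of_nat n / 2) * phase {..<n} \<tau> u"
      unfolding eigenvalue_def phase_def exp_add[symmetric]
      by (intro arg_cong[where f = exp]) (simp add: field_simps)
    ultimately show "exp (?z * eigenvalue n u) * ?w u = exp (\<i> * of_real \<tau> * of_nat n / 2) *
      (walsh u (sym_diff (support a) (support b)) * phase {..<n} \<tau> u) / 2 ^ n"
      by (simp add: mult_ac)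
  qed
  finally show ?thesis
    by (simp add: walsh_transform_def sum_distrib_left sum_divide_distrib)
qed

lemma card_pverts_halved_cube:
  assumes "n > 0" shows "card (pverts (halved_cube n)) = 2 ^ (n - 1)"
  using bij_betw_same_card[OF bij_betw_support_halved_cube[of n]] card_even_subsets[of "{..<n}"] assms
  by auto

lemma uniform_mixing_at_halved_cube_iff:
  assumes "n > 0"
  shows "uniform_mixing_at (halved_cube n) \<tau> \<longleftrightarrow>
    (\<forall>C\<subseteq>{..<n}. even (card C) \<longrightarrow>
      (norm (walsh_transform {..<n} (phase {..<n} \<tau>) C))\<^sup>2 = 2 ^ (n + 1))"
    (is "?L \<longleftrightarrow> (\<forall>C\<subseteq>{..<n}. even (card C) \<longrightarrow> (?g C)\<^sup>2 = _)")
proof -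
  let ?V = "pverts (halved_cube n)"
  have norm: "cmod (transition_matrix (halved_cube n) \<tau> a b) = 1 / sqrt (real (card ?V))
      \<longleftrightarrow> (?g (sym_diff (support a) (support b)))\<^sup>2 = 2 ^ (n + 1)" if "a \<in> ?V" "b \<in> ?V" for a b
  proof -
    let ?x = "?g (sym_diff (support a) (support b))"
    have "cmod (transition_matrix (halved_cube n) \<tau> a b) = ?x / 2 ^ n"
      using transition_matrix_halved_cube[OF that] by (simp add: norm_mult norm_divide norm_power)
    \<comment> \<open>Both sides are nonnegative, so squaring is reversible; the target becomes
      \<open>2 ^ (2 * n) / 2 ^ (n - 1) = 2 ^ (n + 1)\<close>.\<close>
    moreover have "?x / 2 ^ n = 1 / sqrt (2 ^ (n - 1)) \<longleftrightarrow> (?x / 2 ^ n)\<^sup>2 = (1 / sqrt (2 ^ (n - 1)))\<^sup>2"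
      by (subst power2_eq_iff_nonneg) auto
    moreover have "(?x / 2 ^ n)\<^sup>2 = (1 / sqrt (2 ^ (n - 1)))\<^sup>2 \<longleftrightarrow> ?x\<^sup>2 = 2 ^ (n + 1)"
    proof -
      have "(2 ^ n)\<^sup>2 = 2 ^ (n + 1) * (2 :: real) ^ (n - 1)"
        using assms by (cases n) (simp_all add: power2_eq_square)
      then show ?thesis
        by (simp add: power_divide divide_eq_eq)
    qed
    ultimately show ?thesis
      using assms by (simp add: card_pverts_halved_cube)
  qed
  show ?thesis
  proof
    assume L: ?L
    \<comment> \<open>Against the zero word, the symmetric difference of supports is the support of
      the other word, which runs through all even sets.\<close>
    have empty: "support (replicate n False) = {}"
      by (auto simp: support_def)
    then have zero: "replicate n False \<in> ?V"
      by (simp add: halved_cube_def hamming_weight_eq)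
    show "\<forall>C\<subseteq>{..<n}. even (card C) \<longrightarrow> (?g C)\<^sup>2 = 2 ^ (n + 1)"
    proof (intro allI impI)
      fix C assume "C \<subseteq> {..<n}" "even (card C)"
      then obtain b where b: "b \<in> ?V" "C = support b"
        using bij_betw_imp_surj_on[OF bij_betw_support_halved_cube[of n]] by blast
      have "cmod (transition_matrix (halved_cube n) \<tau> (replicate n False) b)
          = 1 / sqrt (real (card ?V))"
        using L zero b(1) unfolding uniform_mixing_at_def by blast
      then show "(?g C)\<^sup>2 = 2 ^ (n + 1)"
        using norm[OF zero b(1)] by (simp add: empty b(2))
    qed
  next
    assume R: "\<forall>C\<subseteq>{..<n}. even (card C) \<longrightarrow> (?g C)\<^sup>2 = 2 ^ (n + 1)"
    show ?L
      unfolding uniform_mixing_at_def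
    proof (intro ballI)
      fix a b assume ab: "a \<in> ?V" "b \<in> ?V"
      have "even (card (sym_diff (support a) (support b)))"
        using ab[THEN support_halved_cube] by (subst even_card_sym_diff) (auto simp: finite_subset)
      moreover have "sym_diff (support a) (support b) \<subseteq> {..<n}"
        using ab[THEN support_halved_cube] by auto
      ultimately show "cmod (transition_matrix (halved_cube n) \<tau> a b) = 1 / sqrt (real (card ?V))"
        using R norm[OF ab] by blast
    qed
  qed
qed

theorem theorem5p2:
  fixes n :: nat
  assumes "n \<ge> 3"
  shows "admits_uniform_mixing (halved_cube n) \<longleftrightarrow> odd n"
proof
  assume "admits_uniform_mixing (halved_cube n)"
  then show "odd n"
    using not_flat_even[of "{..<n}"] assms
    by (auto simp: admits_uniform_mixing_def uniform_mixing_at_halved_cube_iff)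
next
  assume "odd n"
  then have "uniform_mixing_at (halved_cube n) (pi / 4)"
    using flat_odd[of "{..<n}"] assms by (simp add: uniform_mixing_at_halved_cube_iff)
  then show "admits_uniform_mixing (halved_cube n)"
    by (auto simp: admits_uniform_mixing_def)
qed

end
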